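(* Let $W_\alpha$ be a subnormal weighted shift with moments $\{\gamma_n\}_{n\ge0}$, let $x>0$, and let $\ell\ge1$ and $k\ge1$ be integers. Then $W_{\alpha(x)}^{\ell}$ is $k$-hyponormal if and only if the $(k+1)\times(k+1)$ matrix $$D_{k;\ell}:=\begin{pmatrix}\frac1{x^2}&\gamma_{\ell-1}&\gamma_{2\ell-1}&\cdots&\gamma_{k\ell-1}\\ \gamma_{\ell-1}&\gamma_{2\ell-1}&\gamma_{3\ell-1}&\cdots&\gamma_{(k+1)\ell-1}\\ \gamma_{2\ell-1}&\gamma_{3\ell-1}&\gamma_{4\ell-1}&\cdots&\gamma_{(k+2)\ell-1}\\ \vdots&\vdots&\vdots&\ddots&\vdots\\ \gamma_{k\ell-1}&\gamma_{(k+1)\ell-1}&\gamma_{(k+2)\ell-1}&\cdots&\gamma_{2k\ell-1}\end{pmatrix}$$ (whose $(i,j)$ entry, $0\le i,j\le k$, is $\gamma_{(i+j)\ell-1}$ for $(i,j)\ne(0,0)$ and $1/x^2$ for $(i,j)=(0,0)$) is positive semidefinite.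
   Context: A weight sequence is a bounded sequence of positive numbers $\alpha=\{\alpha_n\}_{n=0}^\infty$; the weighted shift $W_\alpha$ is the bounded operator on $\ell^2(\mathbf{Z}_+)$ with $W_\alpha e_n:=\alpha_n e_{n+1}$ ($n\ge 0$), where $\{e_n\}$ is the canonical orthonormal basis. The moments of $\alpha$ are $\gamma_0:=1$ and $\gamma_n:=\alpha_0^2\cdots\alpha_{n-1}^2$ ($n\ge1$). For $x>0$, the back-step extension $\alpha(x)$ is the weight sequence $x,\alpha_0,\alpha_1,\alpha_2,\dots$. An operator is subnormal if it is the restriction of a normal operator to an invariant subspace. With $[A,B]:=AB-BA$, an operator $T$ is $k$-hyponormal if the $k\times k$ operator matrix $([T^{*j},T^i])_{i,j=1}^k$ is positive (semidefinite), equivalently if $(T^{*j}T^i)_{i,j=0}^k$ is positive (semidefinite). *)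

theory Defs
  imports
    "HOL-Analysis.L2_Norm"
    "HOL-Library.Nonpos_Ints"
    "Jordan_Normal_Form.Matrix"
begin

section \<open>Complex Hilbert spaces and their operators\<close>

text \<open>The inner product is linear in its first and conjugate-linear in its second argument.\<close>

class complex_inner = real_normed_vector +
  fixes scaleC :: "complex \<Rightarrow> 'a \<Rightarrow> 'a" (infixr "*\<^sub>C" 75)
    and cinner :: "'a \<Rightarrow> 'a \<Rightarrow> complex"
  assumes scaleC_add_right: "a *\<^sub>C (x + y) = a *\<^sub>C x + a *\<^sub>C y"
    and scaleC_add_left: "(a + b) *\<^sub>C x = a *\<^sub>C x + b *\<^sub>C x"
    and scaleC_scaleC: "a *\<^sub>C (b *\<^sub>C x) = (a * b) *\<^sub>C x"
    and scaleR_scaleC: "r *\<^sub>R x = of_real r *\<^sub>C x"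
    and cinner_commute: "cinner x y = cnj (cinner y x)"
    and cinner_add_left: "cinner (x + y) z = cinner x z + cinner y z"
    and cinner_scaleC_left: "cinner (a *\<^sub>C x) y = a * cinner x y"
    and cinner_self: "cinner x x = of_real ((norm x)\<^sup>2)"

class chilbert_space = complex_inner + complete_space

definition bounded_clinear :: "('a::complex_inner \<Rightarrow> 'b::complex_inner) \<Rightarrow> bool" where
  "bounded_clinear T \<longleftrightarrow> bounded_linear T \<and> (\<forall>a x. T (a *\<^sub>C x) = a *\<^sub>C T x)"

text \<open>On a Hilbert space the adjoint of a bounded operator exists (Riesz) and is unique, so the
  description below is proper whenever it is used.\<close>

definition cadjoint :: "('a::chilbert_space \<Rightarrow> 'a) \<Rightarrow> ('a \<Rightarrow> 'a)" where
  "cadjoint T = (THE S. \<forall>x y. cinner (T x) y = cinner x (S y))"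

definition commutator :: "('a::ab_group_add \<Rightarrow> 'a) \<Rightarrow> ('a \<Rightarrow> 'a) \<Rightarrow> ('a \<Rightarrow> 'a)" where
  "commutator A B = (\<lambda>x. A (B x) - B (A x))"

definition normal_operator :: "('a::chilbert_space \<Rightarrow> 'a) \<Rightarrow> bool" where
  "normal_operator N \<longleftrightarrow> bounded_clinear N \<and> commutator (cadjoint N) N = (\<lambda>x. 0)"

text \<open>The linear isometry \<open>V\<close> identifies the space of \<open>T\<close> with the closed subspace \<open>range V\<close>, which
  is invariant under \<open>N\<close> and on which \<open>N\<close> acts as \<open>T\<close>. HOL cannot quantify over the type of the
  larger Hilbert space inside a definition, so that type is a parameter. As a hypothesis with a
  type variable for \<open>'b\<close>, the predicate amounts to the existence of a normal extension on some
  Hilbert space.\<close>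

definition subnormal_in ::
    "'b::chilbert_space itself \<Rightarrow> ('a::chilbert_space \<Rightarrow> 'a) \<Rightarrow> bool" where
  "subnormal_in K T \<longleftrightarrow> bounded_clinear T \<and>
     (\<exists>(N :: 'b \<Rightarrow> 'b) (V :: 'a \<Rightarrow> 'b). normal_operator N \<and>
        bounded_clinear V \<and> (\<forall>x. norm (V x) = norm x) \<and> (\<forall>x. N (V x) = V (T x)))"

text \<open>Positivity of the operator matrix with \<open>(i,j)\<close> entry \<open>[T\<^sup>*\<^sup>j, T\<^sup>i]\<close>, as an operator on the
  direct sum of \<open>k\<close> copies of the space: its quadratic form takes real nonnegative values.\<close>

definition k_hyponormal :: "nat \<Rightarrow> ('a::chilbert_space \<Rightarrow> 'a) \<Rightarrow> bool" where
  "k_hyponormal k T \<longleftrightarrow> bounded_clinear T \<and>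
     (\<forall>x :: nat \<Rightarrow> 'a.
        (\<Sum>i=1..k. \<Sum>j=1..k. cinner (commutator (cadjoint T ^^ j) (T ^^ i) (x j)) (x i))
          \<in> \<real>\<^sub>\<ge>\<^sub>0)"


section \<open>The Hilbert space of square-summable sequences\<close>

typedef ell2 = "{f :: nat \<Rightarrow> complex. summable (\<lambda>n. (cmod (f n))\<^sup>2)}"
  morphisms ell2_nth Abs_ell2
  by (rule exI[of _ "\<lambda>_. 0"]) simp

setup_lifting type_definition_ell2

lemma ell2_L2_bound_summable:
  assumes "\<And>N. L2_set (\<lambda>n. cmod (f n)) {..<N} \<le> B"
  shows "summable (\<lambda>n. (cmod (f n))\<^sup>2)" and "sqrt (\<Sum>n. (cmod (f n))\<^sup>2) \<le> B"
proof -
  have B: "0 \<le> B" using assms[of 0] by simp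
  have le: "(\<Sum>n<N. (cmod (f n))\<^sup>2) \<le> B\<^sup>2" for N
    using assms[of N] B unfolding L2_set_def by (meson real_sqrt_le_iff real_le_lsqrt
        sqrt_le_D)
  show s: "summable (\<lambda>n. (cmod (f n))\<^sup>2)"
    by (rule summableI_nonneg_bounded[where x = "B\<^sup>2"]) (use le in auto)
  have "(\<Sum>n. (cmod (f n))\<^sup>2) \<le> B\<^sup>2"
    by (rule suminf_le_const[OF s le])
  then show "sqrt (\<Sum>n. (cmod (f n))\<^sup>2) \<le> B"
    using B by (simp add: real_le_lsqrt suminf_nonneg s)
qed

lemma L2_set_le_ell2:
  assumes "summable (\<lambda>n. (cmod (f n))\<^sup>2)"
  shows "L2_set (\<lambda>n. cmod (f n)) {..<N} \<le> sqrt (\<Sum>n. (cmod (f n))\<^sup>2)"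
  unfolding L2_set_def by (intro real_sqrt_le_mono sum_le_suminf assms) auto

lemma ell2_triangle:
  assumes f: "summable (\<lambda>n. (cmod (f n))\<^sup>2)" and g: "summable (\<lambda>n. (cmod (g n))\<^sup>2)"
  shows "summable (\<lambda>n. (cmod (f n + g n))\<^sup>2)"
    and "sqrt (\<Sum>n. (cmod (f n + g n))\<^sup>2)
      \<le> sqrt (\<Sum>n. (cmod (f n))\<^sup>2) + sqrt (\<Sum>n. (cmod (g n))\<^sup>2)"
proof -
  have *: "L2_set (\<lambda>n. cmod (f n + g n)) {..<N}
      \<le> sqrt (\<Sum>n. (cmod (f n))\<^sup>2) + sqrt (\<Sum>n. (cmod (g n))\<^sup>2)" for N
  proof -
    have "L2_set (\<lambda>n. cmod (f n + g n)) {..<N} \<le> L2_set (\<lambda>n. cmod (f n) + cmod (g n)) {..<N}"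
      by (rule L2_set_mono) (auto intro: norm_triangle_ineq)
    also have "\<dots> \<le> L2_set (\<lambda>n. cmod (f n)) {..<N} + L2_set (\<lambda>n. cmod (g n)) {..<N}"
      by (rule L2_set_triangle_ineq)
    finally show ?thesis
      using L2_set_le_ell2[OF f, of N] L2_set_le_ell2[OF g, of N] by linarith
  qed
  show "summable (\<lambda>n. (cmod (f n + g n))\<^sup>2)"
    by (rule ell2_L2_bound_summable(1)[OF *])
  show "sqrt (\<Sum>n. (cmod (f n + g n))\<^sup>2)
      \<le> sqrt (\<Sum>n. (cmod (f n))\<^sup>2) + sqrt (\<Sum>n. (cmod (g n))\<^sup>2)"
    by (rule ell2_L2_bound_summable(2)[OF *])
qed

lemma ell2_scale_summable:
  "summable (\<lambda>n. (cmod (f n))\<^sup>2) \<Longrightarrow> summable (\<lambda>n. (cmod (a * f n))\<^sup>2)"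
  by (simp add: norm_mult power_mult_distrib summable_mult)

lemma ell2_cinner_summable:
  assumes f: "summable (\<lambda>n. (cmod (f n))\<^sup>2)" and g: "summable (\<lambda>n. (cmod (g n))\<^sup>2)"
  shows "summable (\<lambda>n. f n * cnj (g n))"
proof (rule summable_comparison_test'[OF summable_add[OF f g], of 0])
  fix n
  have "2 * (cmod (f n) * cmod (g n)) \<le> (cmod (f n))\<^sup>2 + (cmod (g n))\<^sup>2"
    using sum_squares_bound[of "cmod (f n)" "cmod (g n)"] by (simp add: mult.assoc)
  moreover have "0 \<le> cmod (f n) * cmod (g n)" by simp
  ultimately show "norm (f n * cnj (g n)) \<le> (cmod (f n))\<^sup>2 + (cmod (g n))\<^sup>2"
    unfolding norm_mult complex_mod_cnj by linarith
qed

instantiation ell2 :: real_normed_vector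
begin

lift_definition zero_ell2 :: ell2 is "\<lambda>n. 0" by simp
lift_definition plus_ell2 :: "ell2 \<Rightarrow> ell2 \<Rightarrow> ell2" is "\<lambda>f g n. f n + g n"
  by (rule ell2_triangle(1))
lift_definition uminus_ell2 :: "ell2 \<Rightarrow> ell2" is "\<lambda>f n. - f n" by simp
lift_definition minus_ell2 :: "ell2 \<Rightarrow> ell2 \<Rightarrow> ell2" is "\<lambda>f g n. f n - g n"
  subgoal for f g using ell2_triangle(1)[of f "\<lambda>n. - g n"] by simp
  done
lift_definition scaleR_ell2 :: "real \<Rightarrow> ell2 \<Rightarrow> ell2" is "\<lambda>r f n. of_real r * f n"
  by (rule ell2_scale_summable)
lift_definition norm_ell2 :: "ell2 \<Rightarrow> real" is "\<lambda>f. sqrt (\<Sum>n. (cmod (f n))\<^sup>2)" .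
definition dist_ell2 :: "ell2 \<Rightarrow> ell2 \<Rightarrow> real" where "dist_ell2 x y = norm (x - y)"
definition sgn_ell2 :: "ell2 \<Rightarrow> ell2" where "sgn_ell2 x = inverse (norm x) *\<^sub>R x"
definition uniformity_ell2 :: "(ell2 \<times> ell2) filter" where
  "uniformity_ell2 = (INF e\<in>{0 <..}. principal {(x, y). dist x y < e})"
definition open_ell2 :: "ell2 set \<Rightarrow> bool" where
  "open_ell2 U \<longleftrightarrow> (\<forall>x\<in>U. eventually (\<lambda>(x', y). x' = x \<longrightarrow> y \<in> U) uniformity)"

instance
proof
  fix x y z :: ell2 and a b :: real
  show "x + y + z = x + (y + z)" by transfer (simp add: add.assoc)
  show "x + y = y + x" by transfer (simp add: add.commute)
  show "0 + x = x" by transfer simp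
  show "- x + x = 0" by transfer simp
  show "x - y = x + - y" by transfer simp
  show "a *\<^sub>R (x + y) = a *\<^sub>R x + a *\<^sub>R y" by transfer (simp add: distrib_left)
  show "(a + b) *\<^sub>R x = a *\<^sub>R x + b *\<^sub>R x" by transfer (simp add: distrib_right)
  show "a *\<^sub>R b *\<^sub>R x = (a * b) *\<^sub>R x" by transfer (simp add: mult.assoc)
  show "1 *\<^sub>R x = x" by transfer simp
  show "dist x y = norm (x - y)" by (rule dist_ell2_def)
  show "sgn x = inverse (norm x) *\<^sub>R x" by (rule sgn_ell2_def)
  show "uniformity = (INF e\<in>{0 <..}. principal {(x, y :: ell2). dist x y < e})"
    by (rule uniformity_ell2_def)
  show "open U \<longleftrightarrow> (\<forall>x\<in>U. eventually (\<lambda>(x', y). x' = x \<longrightarrow> y \<in> U) uniformity)"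
    for U :: "ell2 set"
    by (rule open_ell2_def)
  show "norm x = 0 \<longleftrightarrow> x = 0"
    by transfer (simp add: suminf_eq_zero_iff fun_eq_iff)
  show "norm (x + y) \<le> norm x + norm y" by transfer (rule ell2_triangle(2))
  show "norm (a *\<^sub>R x) = \<bar>a\<bar> * norm x"
    by transfer (simp add: norm_mult power_mult_distrib suminf_mult real_sqrt_mult)
qed

end

lemma norm_ell2_nth_le: "cmod (ell2_nth x n) \<le> norm x"
proof (transfer fixing: n)
  fix f :: "nat \<Rightarrow> complex"
  assume f: "summable (\<lambda>n. (cmod (f n))\<^sup>2)"
  have "cmod (f n) \<le> L2_set (\<lambda>n. cmod (f n)) {..<Suc n}"
    by (rule member_le_L2_set) auto
  also have "\<dots> \<le> sqrt (\<Sum>n. (cmod (f n))\<^sup>2)" by (rule L2_set_le_ell2[OF f])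
  finally show "cmod (f n) \<le> sqrt (\<Sum>n. (cmod (f n))\<^sup>2)" .
qed

instantiation ell2 :: complex_inner
begin

lift_definition scaleC_ell2 :: "complex \<Rightarrow> ell2 \<Rightarrow> ell2" is "\<lambda>a f n. a * f n"
  by (rule ell2_scale_summable)
lift_definition cinner_ell2 :: "ell2 \<Rightarrow> ell2 \<Rightarrow> complex" is "\<lambda>f g. \<Sum>n. f n * cnj (g n)" .

instance
proof
  fix x y z :: ell2 and a b :: complex and r :: real
  show "a *\<^sub>C (x + y) = a *\<^sub>C x + a *\<^sub>C y" by transfer (simp add: distrib_left)
  show "(a + b) *\<^sub>C x = a *\<^sub>C x + b *\<^sub>C x" by transfer (simp add: distrib_right)
  show "a *\<^sub>C (b *\<^sub>C x) = (a * b) *\<^sub>C x" by transfer (simp add: mult.assoc)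
  show "r *\<^sub>R x = of_real r *\<^sub>C x" by transfer simp
  show "cinner x y = cnj (cinner y x)"
  proof transfer
    fix f g :: "nat \<Rightarrow> complex"
    assume "summable (\<lambda>n. (cmod (f n))\<^sup>2)" "summable (\<lambda>n. (cmod (g n))\<^sup>2)"
    then have "(\<lambda>n. g n * cnj (f n)) sums (\<Sum>n. g n * cnj (f n))"
      by (intro summable_sums ell2_cinner_summable)
    then have "(\<lambda>n. cnj (g n * cnj (f n))) sums cnj (\<Sum>n. g n * cnj (f n))"
      by (simp only: sums_cnj)
    then show "(\<Sum>n. f n * cnj (g n)) = cnj (\<Sum>n. g n * cnj (f n))"
      by (simp add: sums_iff mult.commute)
  qed
  show "cinner (x + y) z = cinner x z + cinner y z"
    by transfer (simp add: distrib_right suminf_add ell2_cinner_summable)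
  show "cinner (a *\<^sub>C x) y = a * cinner x y"
    by transfer (simp add: mult.assoc suminf_mult ell2_cinner_summable)
  show "cinner x x = of_real ((norm x)\<^sup>2)"
  proof transfer
    fix f :: "nat \<Rightarrow> complex"
    assume f: "summable (\<lambda>n. (cmod (f n))\<^sup>2)"
    have "(\<Sum>n. f n * cnj (f n)) = (\<Sum>n. of_real ((cmod (f n))\<^sup>2))"
      by (simp only: complex_norm_square)
    also have "\<dots> = of_real (\<Sum>n. (cmod (f n))\<^sup>2)"
      by (rule suminf_of_real[OF f, symmetric])
    finally show "(\<Sum>n. f n * cnj (f n)) = of_real ((sqrt (\<Sum>n. (cmod (f n))\<^sup>2))\<^sup>2)"
      by (simp add: suminf_nonneg[OF f])
  qed
qed

end

instance ell2 :: chilbert_space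
proof
  fix X :: "nat \<Rightarrow> ell2"
  assume X: "Cauchy X"
  have nth_diff: "ell2_nth (x - y) n = ell2_nth x n - ell2_nth y n" for x y n
    by transfer simp
  have "Cauchy (\<lambda>m. ell2_nth (X m) n)" for n
    unfolding Cauchy_def
  proof (intro allI impI)
    fix e :: real assume "e > 0"
    then obtain M where M: "\<forall>m\<ge>M. \<forall>p\<ge>M. dist (X m) (X p) < e"
      using X unfolding Cauchy_def by blast
    have "dist (ell2_nth (X m) n) (ell2_nth (X p) n) < e" if "m \<ge> M" "p \<ge> M" for m p
      using norm_ell2_nth_le[of "X m - X p" n] M that
      by (fastforce simp: dist_norm nth_diff)
    then show "\<exists>M. \<forall>m\<ge>M. \<forall>p\<ge>M. dist (ell2_nth (X m) n) (ell2_nth (X p) n) < e"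
      by blast
  qed
  then have "\<forall>n. \<exists>c. (\<lambda>m. ell2_nth (X m) n) \<longlonglongrightarrow> c"
    by (simp add: Cauchy_convergent_iff convergent_def)
  then obtain f where f: "\<And>n. (\<lambda>m. ell2_nth (X m) n) \<longlonglongrightarrow> f n"
    by metis
  have close: "\<exists>M. \<forall>m\<ge>M. \<forall>N. L2_set (\<lambda>n. cmod (f n - ell2_nth (X m) n)) {..<N} \<le> e"
    if e: "e > 0" for e
  proof -
    obtain M where M: "\<forall>m\<ge>M. \<forall>p\<ge>M. dist (X m) (X p) < e"
      using X e unfolding Cauchy_def by blast
    have "L2_set (\<lambda>n. cmod (f n - ell2_nth (X m) n)) {..<N} \<le> e" if m: "m \<ge> M" for m N
    proof (rule LIMSEQ_le_const2)
      show "(\<lambda>p. L2_set (\<lambda>n. cmod (ell2_nth (X p) n - ell2_nth (X m) n)) {..<N})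
          \<longlonglongrightarrow> L2_set (\<lambda>n. cmod (f n - ell2_nth (X m) n)) {..<N}"
        unfolding L2_set_def by (intro tendsto_intros f)
      have "L2_set (\<lambda>n. cmod (ell2_nth (X p) n - ell2_nth (X m) n)) {..<N} \<le> e"
        if p: "p \<ge> M" for p
      proof -
        have "L2_set (\<lambda>n. cmod (ell2_nth (X p - X m) n)) {..<N} \<le> norm (X p - X m)"
          unfolding norm_ell2.rep_eq using ell2_nth[of "X p - X m"]
          by (intro L2_set_le_ell2) simp
        also have "\<dots> \<le> e" using M m p by (force simp: dist_norm)
        finally show ?thesis by (simp add: nth_diff)
      qed
      then show "\<exists>M. \<forall>p\<ge>M. L2_set (\<lambda>n. cmod (ell2_nth (X p) n - ell2_nth (X m) n)) {..<N} \<le> e"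
        by blast
    qed
    then show ?thesis by blast
  qed
  obtain M where M: "\<And>N. L2_set (\<lambda>n. cmod (f n - ell2_nth (X M) n)) {..<N} \<le> 1"
    using close[of 1] by auto
  have "summable (\<lambda>n. (cmod ((f n - ell2_nth (X M) n) + ell2_nth (X M) n))\<^sup>2)"
    using ell2_nth[of "X M"] by (intro ell2_triangle(1) ell2_L2_bound_summable(1)[OF M]) simp
  then have sf: "summable (\<lambda>n. (cmod (f n))\<^sup>2)" by simp
  define L where "L = Abs_ell2 f"
  have L: "ell2_nth L = f" unfolding L_def using sf by (simp add: Abs_ell2_inverse)
  have "X \<longlonglongrightarrow> L"
  proof (rule metric_LIMSEQ_I)
    fix e :: real assume "e > 0"
    then obtain M where M: "\<And>m N. m \<ge> M \<Longrightarrow>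
        L2_set (\<lambda>n. cmod (f n - ell2_nth (X m) n)) {..<N} \<le> e / 2"
      using close[of "e / 2"] by auto
    have "dist (X m) L < e" if "m \<ge> M" for m
    proof -
      have "norm (L - X m) \<le> e / 2"
        unfolding norm_ell2.rep_eq nth_diff L by (rule ell2_L2_bound_summable(2)[OF M[OF that]])
      then show ?thesis using \<open>e > 0\<close> by (simp add: dist_norm norm_minus_commute)
    qed
    then show "\<exists>M. \<forall>m\<ge>M. dist (X m) L < e" by blast
  qed
  then show "convergent X" by (auto simp: convergent_def)
qed

lift_definition ell2_basis :: "nat \<Rightarrow> ell2" is "\<lambda>m n. if n = m then 1 else 0"
  subgoal for m by (rule summable_finite[of "{m}"]) auto
  done


section \<open>Weighted shifts\<close>

definition weight_sequence :: "(nat \<Rightarrow> real) \<Rightarrow> bool" where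
  "weight_sequence \<alpha> \<longleftrightarrow> Bseq \<alpha> \<and> (\<forall>n. 0 < \<alpha> n)"

text \<open>Only meaningful for bounded \<open>\<alpha>\<close>. The two lemmas below show that it is then a bounded operator
  taking the basis vector \<open>e\<^sub>n\<close> to \<open>\<alpha>\<^sub>n e\<^sub>n\<^sub>+\<^sub>1\<close>.\<close>

definition weighted_shift :: "(nat \<Rightarrow> real) \<Rightarrow> ell2 \<Rightarrow> ell2" where
  "weighted_shift \<alpha> f =
     Abs_ell2 (\<lambda>n. case n of 0 \<Rightarrow> 0 | Suc m \<Rightarrow> of_real (\<alpha> m) * ell2_nth f m)"

lemma weighted_shift_bound:
  assumes K: "\<And>n. \<bar>\<alpha> n\<bar> \<le> K" and f: "summable (\<lambda>n. (cmod (f n))\<^sup>2)"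
  defines "g \<equiv> \<lambda>n. case n of 0 \<Rightarrow> 0 | Suc m \<Rightarrow> of_real (\<alpha> m) * f m"
  shows "summable (\<lambda>n. (cmod (g n))\<^sup>2)"
    and "sqrt (\<Sum>n. (cmod (g n))\<^sup>2) \<le> K * sqrt (\<Sum>n. (cmod (f n))\<^sup>2)"
proof -
  have K0: "0 \<le> K" using K[of 0] by simp
  have *: "(cmod (g (Suc n)))\<^sup>2 \<le> K\<^sup>2 * (cmod (f n))\<^sup>2" for n
    unfolding g_def using power_mono[OF K[of n], of 2]
    by (auto simp: norm_mult power_mult_distrib intro!: mult_right_mono)
  have s: "summable (\<lambda>n. (cmod (g (Suc n)))\<^sup>2)"
    by (rule summable_comparison_test'[OF summable_mult[OF f, of "K\<^sup>2"], of 0]) (use * in auto)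
  then show s': "summable (\<lambda>n. (cmod (g n))\<^sup>2)"
    by (subst (asm) summable_Suc_iff)
  have "(\<Sum>n. (cmod (g n))\<^sup>2) = (\<Sum>n. (cmod (g (Suc n)))\<^sup>2)"
    using suminf_split_head[OF s'] by (simp add: g_def)
  also have "\<dots> \<le> (\<Sum>n. K\<^sup>2 * (cmod (f n))\<^sup>2)"
    by (rule suminf_le[OF * s summable_mult[OF f]])
  also have "\<dots> = K\<^sup>2 * (\<Sum>n. (cmod (f n))\<^sup>2)"
    by (rule suminf_mult[OF f])
  finally have "sqrt (\<Sum>n. (cmod (g n))\<^sup>2) \<le> sqrt (K\<^sup>2 * (\<Sum>n. (cmod (f n))\<^sup>2))"
    by (rule real_sqrt_le_mono)
  then show "sqrt (\<Sum>n. (cmod (g n))\<^sup>2) \<le> K * sqrt (\<Sum>n. (cmod (f n))\<^sup>2)"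
    using K0 by (simp add: real_sqrt_mult)
qed

lemma ell2_nth_weighted_shift:
  assumes "Bseq \<alpha>"
  shows "ell2_nth (weighted_shift \<alpha> f) =
    (\<lambda>n. case n of 0 \<Rightarrow> 0 | Suc m \<Rightarrow> of_real (\<alpha> m) * ell2_nth f m)"
proof -
  obtain K where "\<And>n. \<bar>\<alpha> n\<bar> \<le> K" using assms by (auto simp: Bseq_def)
  from weighted_shift_bound(1)[OF this] ell2_nth[of f] show ?thesis
    unfolding weighted_shift_def by (intro Abs_ell2_inverse) simp
qed

lemma bounded_clinear_weighted_shift:
  assumes "Bseq \<alpha>"
  shows "bounded_clinear (weighted_shift \<alpha>)"
proof -
  note nth = ell2_nth_weighted_shift[OF assms]
  obtain K where K: "\<And>n. \<bar>\<alpha> n\<bar> \<le> K" using assms by (auto simp: Bseq_def)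
  have "norm (weighted_shift \<alpha> f) \<le> norm f * K" for f
    unfolding norm_ell2.rep_eq nth
    using weighted_shift_bound(2)[OF K] ell2_nth[of f] by (simp add: mult.commute)
  moreover have "weighted_shift \<alpha> (f + g) = weighted_shift \<alpha> f + weighted_shift \<alpha> g" for f g
    by (rule ell2_nth_inject[THEN iffD1])
      (auto simp: nth plus_ell2.rep_eq fun_eq_iff algebra_simps split: nat.split)
  moreover have "weighted_shift \<alpha> (c *\<^sub>R f) = c *\<^sub>R weighted_shift \<alpha> f" for c f
    by (rule ell2_nth_inject[THEN iffD1])
      (auto simp: nth scaleR_ell2.rep_eq fun_eq_iff algebra_simps split: nat.split)
  moreover have "weighted_shift \<alpha> (c *\<^sub>C f) = c *\<^sub>C weighted_shift \<alpha> f" for c f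
    by (rule ell2_nth_inject[THEN iffD1])
      (auto simp: nth scaleC_ell2.rep_eq fun_eq_iff algebra_simps split: nat.split)
  ultimately show ?thesis
    unfolding bounded_clinear_def by (metis bounded_linear_intro)
qed

lemma weighted_shift_basis:
  assumes "Bseq \<alpha>"
  shows "weighted_shift \<alpha> (ell2_basis n) = \<alpha> n *\<^sub>R ell2_basis (Suc n)"
  by (rule ell2_nth_inject[THEN iffD1])
    (auto simp: ell2_nth_weighted_shift[OF assms] ell2_basis.rep_eq scaleR_ell2.rep_eq
      fun_eq_iff split: nat.split)

definition moment :: "(nat \<Rightarrow> real) \<Rightarrow> nat \<Rightarrow> real" where
  "moment \<alpha> n = (\<Prod>i<n. (\<alpha> i)\<^sup>2)"

definition back_step :: "real \<Rightarrow> (nat \<Rightarrow> real) \<Rightarrow> (nat \<Rightarrow> real)" where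
  "back_step x \<alpha> = (\<lambda>n. case n of 0 \<Rightarrow> x | Suc m \<Rightarrow> \<alpha> m)"


section \<open>The moment matrix\<close>

definition pos_semidef :: "real mat \<Rightarrow> bool" where
  "pos_semidef A \<longleftrightarrow> square_mat A \<and> transpose_mat A = A \<and>
     (\<forall>v \<in> carrier_vec (dim_row A). 0 \<le> v \<bullet> (A *\<^sub>v v))"

definition D_matrix :: "(nat \<Rightarrow> real) \<Rightarrow> real \<Rightarrow> nat \<Rightarrow> nat \<Rightarrow> real mat" where
  "D_matrix \<alpha> x k l = mat (k + 1) (k + 1)
     (\<lambda>(i, j). if (i, j) = (0, 0) then 1 / x\<^sup>2 else moment \<alpha> ((i + j) * l - 1))"

end

theory Submission
  imports Defs
begin

text \<open>
  Let \<open>\<beta>\<close> be the back-step extension \<open>\<alpha>(x)\<close>, with moments \<open>b\<^sub>n\<close>, and let \<open>T = W\<^sub>\<beta>\<^sup>l\<close>. Completing the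
  square in the component \<open>y\<^sub>0\<close> (a Schur complement with respect to the identity in the corner) shows
  that \<open>T\<close> is \<open>k\<close>-hyponormal exactly when \<open>\<Sum> \<langle>T\<^sup>i y\<^sub>j, T\<^sup>j y\<^sub>i\<rangle>\<close>, summed over \<open>0 \<le> i, j \<le> k\<close>, is nonnegative
  for all vectors \<open>y\<^sub>0, \<dots>, y\<^sub>k\<close> (\<open>k_hyponormal_iff_form\<close>).

  A power of a shift moves every coordinate by a fixed amount, so in coordinates this form is an
  orthogonal sum of finite-dimensional forms, one for each integer \<open>n\<close>: the coordinates
  \<open>y\<^sub>j(n + j l)\<close>, divided by \<open>sqrt (b (n + j l))\<close>, enter through the Hankel matrix
  \<open>b (n + (i + j) l)\<close>, restricted to those indices for which \<open>n + i l\<close> and \<open>n + j l\<close> are not negative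
  (\<open>hyponormal_form_shift_sums\<close>). Since \<open>b\<^sub>0 = 1\<close> and \<open>b\<^sub>m\<^sub>+\<^sub>1 = x\<^sup>2 \<gamma>\<^sub>m\<close>, the slice \<open>n = 0\<close> is
  \<open>x\<^sup>2\<close> times the matrix \<open>D\<close>. Every other slice avoids \<open>b\<^sub>0\<close>: for \<open>n > 0\<close> trivially, and for \<open>n < 0\<close>
  because the active indices are all positive. Such a slice is \<open>x\<^sup>2\<close> times a Hankel matrix of the
  subnormal shift \<open>W\<^sub>\<alpha>\<close>, and is always positive (\<open>back_step_slice_nonneg\<close>). So positivity of
  \<open>D\<close> suffices; it is necessary because the vectors \<open>y\<^sub>j = c\<^sub>j T\<^sup>j e\<^sub>0\<close> live in the slice \<open>n = 0\<close> alone.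

  Positivity of the moments of a subnormal operator needs no spectral measure. If \<open>N\<close> is normal,
  then \<open>\<parallel>N\<^sup>a\<^sup>+\<^sup>b w\<parallel>\<^sup>2 = \<langle>N\<^sup>*\<^sup>a N\<^sup>a w, N\<^sup>*\<^sup>b N\<^sup>b w\<rangle>\<close>, so these numbers form a Gram matrix
  (\<open>normal_operator_gram\<close>).
\<close>


section \<open>Complex inner products\<close>

lemma cinner_add_right: "cinner x (y + z) = cinner x y + cinner x (z :: 'a::complex_inner)"
  by (metis cinner_add_left cinner_commute complex_cnj_add)

lemma cinner_scaleC_right: "cinner x (a *\<^sub>C y) = cnj a * cinner x (y :: 'a::complex_inner)"
  by (metis cinner_commute cinner_scaleC_left complex_cnj_mult)

lemma cinner_scaleR_left: "cinner (r *\<^sub>R x) y = of_real r * cinner x (y :: 'a::complex_inner)"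
  by (simp add: scaleR_scaleC cinner_scaleC_left)

lemma cinner_scaleR_right: "cinner x (r *\<^sub>R y) = of_real r * cinner x (y :: 'a::complex_inner)"
  by (simp add: scaleR_scaleC cinner_scaleC_right)

lemma cinner_zero_left [simp]: "cinner 0 (y :: 'a::complex_inner) = 0"
  using cinner_scaleR_left[of 0 0 y] by simp

lemma cinner_zero_right [simp]: "cinner (x :: 'a::complex_inner) 0 = 0"
  using cinner_scaleR_right[of x 0 0] by simp

lemma cinner_minus_left: "cinner (- x) y = - cinner x (y :: 'a::complex_inner)"
  using cinner_scaleR_left[of "-1" x y] by simp

lemma cinner_minus_right: "cinner x (- y) = - cinner x (y :: 'a::complex_inner)"
  using cinner_scaleR_right[of x "-1" y] by simp

lemma cinner_diff_left: "cinner (x - y) z = cinner x z - cinner y (z :: 'a::complex_inner)"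
  using cinner_add_left[of x "- y" z] by (simp add: cinner_minus_left)

lemma cinner_diff_right: "cinner x (y - z) = cinner x y - cinner x (z :: 'a::complex_inner)"
  using cinner_add_right[of x y "- z"] by (simp add: cinner_minus_right)

lemma cinner_sum_left: "cinner (sum f A) (y :: 'a::complex_inner) = (\<Sum>a\<in>A. cinner (f a) y)"
  by (induction A rule: infinite_finite_induct) (simp_all add: cinner_add_left)

lemma cinner_sum_right: "cinner (x :: 'a::complex_inner) (sum f A) = (\<Sum>a\<in>A. cinner x (f a))"
  by (induction A rule: infinite_finite_induct) (simp_all add: cinner_add_right)

lemma Re_cinner_commute: "Re (cinner x y) = Re (cinner y (x :: 'a::complex_inner))"
  by (subst cinner_commute) simp

lemma norm_square_add:
  "(norm (x + y :: 'a::complex_inner))\<^sup>2 = (norm x)\<^sup>2 + 2 * Re (cinner x y) + (norm y)\<^sup>2"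
proof -
  have "Re (cinner (x + y) (x + y)) =
      Re (cinner x x) + Re (cinner x y) + (Re (cinner y x) + Re (cinner y y))"
    by (simp add: cinner_add_left cinner_add_right)
  then show ?thesis by (simp add: cinner_self Re_cinner_commute[of y x] flip: of_real_power)
qed

lemma parallelogram_law:
  "(norm (x + y :: 'a::complex_inner))\<^sup>2 + (norm (x - y))\<^sup>2 = 2 * (norm x)\<^sup>2 + 2 * (norm y)\<^sup>2"
  using norm_square_add[of x y] norm_square_add[of x "- y"] by (simp add: cinner_minus_right)

lemma Re_cinner_le_norm: "Re (cinner x y) \<le> norm x * norm (y :: 'a::complex_inner)"
proof -
  have "(norm (x + y))\<^sup>2 \<le> (norm x + norm y)\<^sup>2"
    by (intro power_mono norm_triangle_ineq) simp
  then show ?thesis by (simp add: norm_square_add power2_sum)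
qed

lemma abs_Re_cinner_le_norm: "\<bar>Re (cinner x y)\<bar> \<le> norm x * norm (y :: 'a::complex_inner)"
  using Re_cinner_le_norm[of x y] Re_cinner_le_norm[of "- x" y]
  by (simp add: cinner_minus_left abs_le_iff)

lemma cinner_right_ext:
  assumes "\<And>x. cinner x y = cinner x (z :: 'a::complex_inner)"
  shows "y = z"
proof -
  have "cinner (y - z) (y - z) = 0"
    using assms[of "y - z"] by (simp add: cinner_diff_right)
  then show ?thesis by (simp add: cinner_self)
qed


section \<open>The Riesz representation theorem and adjoints\<close>

text \<open>The representing vector is the minimiser of the energy \<open>\<parallel>z\<parallel>\<^sup>2 - 2 g z\<close>: the parallelogram law makes
  any minimising sequence Cauchy, and at the minimum the first variation vanishes. Working with real
  parts lets one real functional stand for a complex one, which is determined by its real part.\<close>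

lemma riesz_representation_Re:
  fixes g :: "'a::chilbert_space \<Rightarrow> real"
  assumes "bounded_linear g"
  shows "\<exists>z. \<forall>h. g h = Re (cinner h z)"
proof -
  interpret bounded_linear g by fact
  define J where "J z = (norm z)\<^sup>2 - 2 * g z" for z
  define m where "m = Inf (range J)"
  obtain K where K: "\<And>z. \<bar>g z\<bar> \<le> norm z * K" using bounded by auto
  have lower: "- K\<^sup>2 \<le> J z" for z
  proof -
    have "0 \<le> (norm z - K)\<^sup>2" by simp
    then show ?thesis using K[of z] unfolding J_def power2_diff by (simp add: abs_le_iff)
  qed
  have bdd: "bdd_below (range J)" using lower by (intro bdd_belowI[of _ "- K\<^sup>2"]) auto
  have m_le: "m \<le> J z" for z unfolding m_def by (rule cInf_lower[OF _ bdd]) simp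
  have "\<exists>z. J z < m + 1 / real (Suc n)" for n
  proof -
    have "Inf (range J) < m + 1 / real (Suc n)" by (simp add: m_def)
    then show ?thesis using cInf_lessD[of "range J"] by blast
  qed
  then obtain Z where Z: "\<And>n. J (Z n) < m + 1 / real (Suc n)" by metis
  have gap: "(norm (Z p - Z q))\<^sup>2 \<le> 2 / real (Suc p) + 2 / real (Suc q)" for p q
  proof -
    define c where "c = (1/2) *\<^sub>R (Z p + Z q)"
    have "(norm (Z p + Z q))\<^sup>2 = 4 * (norm c)\<^sup>2"
      by (simp add: c_def power_mult_distrib power_divide)
    moreover have "g c = (g (Z p) + g (Z q)) / 2" by (simp add: c_def scaleR add)
    ultimately have "(norm (Z p - Z q))\<^sup>2 = 2 * J (Z p) + 2 * J (Z q) - 4 * J c"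
      using parallelogram_law[of "Z p" "Z q"] by (simp add: J_def field_simps)
    then show ?thesis using Z[of p] Z[of q] m_le[of c] by simp
  qed
  have "Cauchy Z"
  proof (rule metric_CauchyI)
    fix e :: real assume e: "e > 0"
    then obtain M where M: "4 / e\<^sup>2 < real M" using reals_Archimedean2 by blast
    have "dist (Z p) (Z q) < e" if "p \<ge> M" "q \<ge> M" for p q
    proof -
      have small: "2 / real (Suc r) < e\<^sup>2 / 2" if "r \<ge> M" for r
      proof -
        have "4 / e\<^sup>2 < real (Suc r)" using M that by simp
        then show ?thesis using e by (simp add: field_simps)
      qed
      have "(norm (Z p - Z q))\<^sup>2 < e\<^sup>2" using gap[of p q] small[OF that(1)] small[OF that(2)] by simp
      then show ?thesis using e by (simp add: dist_norm power2_less_imp_less)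
    qed
    then show "\<exists>M. \<forall>p\<ge>M. \<forall>q\<ge>M. dist (Z p) (Z q) < e" by blast
  qed
  then obtain z where z: "Z \<longlonglongrightarrow> z" using Cauchy_convergent_iff convergent_def by blast
  have "(\<lambda>n. J (Z n)) \<longlonglongrightarrow> J z"
    unfolding J_def by (intro tendsto_intros z tendsto)
  moreover have "(\<lambda>n. m + 1 / real (Suc n)) \<longlonglongrightarrow> m + 0"
    by (intro tendsto_add tendsto_const LIMSEQ_Suc lim_1_over_n)
  ultimately have "J z \<le> m + 0"
    by (rule LIMSEQ_le) (use Z less_imp_le in blast)
  then have min: "J z \<le> J w" for w using m_le[of w] by simp
  have "g h = Re (cinner h z)" for h
  proof -
    define d where "d = Re (cinner h z) - g h"
    have quad: "0 \<le> 2 * t * d + t\<^sup>2 * (norm h)\<^sup>2" for t :: real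
      using min[of "z + t *\<^sub>R h"]
      by (simp add: J_def norm_square_add cinner_scaleR_right add scaleR power_mult_distrib
          d_def Re_cinner_commute[of z h] algebra_simps)
    \<comment> \<open>A value of \<open>t\<close> near the vertex \<open>- d / \<parallel>h\<parallel>\<^sup>2\<close> forces \<open>d = 0\<close>; the added \<open>1\<close> covers \<open>h = 0\<close>.\<close>
    define s where "s = 1 + (norm h)\<^sup>2"
    have s: "s > 0" by (simp add: s_def add_pos_nonneg)
    have "0 \<le> 2 * (- d / s) * d + (- d / s)\<^sup>2 * (norm h)\<^sup>2" by (rule quad)
    also have "\<dots> \<le> 2 * (- d / s) * d + (- d / s)\<^sup>2 * s"
      by (intro add_left_mono mult_left_mono) (auto simp: s_def)
    also have "\<dots> = - d\<^sup>2 / s" using s by (simp add: field_simps power2_eq_square)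
    finally have "d\<^sup>2 \<le> 0" using s by (simp add: field_simps)
    then show ?thesis by (simp add: d_def)
  qed
  then show ?thesis by blast
qed

text \<open>The definite description that defines the adjoint denotes something: Riesz gives existence, and
  nondegeneracy of the inner product gives uniqueness.\<close>

lemma cinner_cadjoint:
  fixes T :: "'a::chilbert_space \<Rightarrow> 'a"
  assumes "bounded_clinear T"
  shows "cinner (T x) y = cinner x (cadjoint T y)"
proof -
  interpret bounded_linear T using assms by (simp add: bounded_clinear_def)
  have ex: "\<exists>z. \<forall>x. cinner (T x) y = cinner x z" for y
  proof -
    obtain K where K: "\<And>x. norm (T x) \<le> norm x * K" using bounded by auto
    have "bounded_linear (\<lambda>x. Re (cinner (T x) y))"
    proof (rule bounded_linear_intro)
      fix x
      have "\<bar>Re (cinner (T x) y)\<bar> \<le> norm (T x) * norm y" by (rule abs_Re_cinner_le_norm)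
      also have "\<dots> \<le> (norm x * K) * norm y" by (intro mult_right_mono K) simp
      finally show "norm (Re (cinner (T x) y)) \<le> norm x * (K * norm y)" by (simp add: mult.assoc)
    qed (simp_all add: add scaleR cinner_add_left cinner_scaleR_left)
    then obtain z where z: "\<And>x. Re (cinner (T x) y) = Re (cinner x z)"
      using riesz_representation_Re by blast
    \<comment> \<open>Imaginary parts agree because they are real parts at \<open>\<i> x\<close>.\<close>
    have "cinner (T x) y = cinner x z" for x
    proof (rule complex_eqI)
      have "T (\<i> *\<^sub>C x) = \<i> *\<^sub>C T x" using assms by (simp add: bounded_clinear_def)
      then show "Im (cinner (T x) y) = Im (cinner x z)"
        using z[of "\<i> *\<^sub>C x"] by (simp add: cinner_scaleC_left)
    qed (rule z)
    then show ?thesis by blast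
  qed
  then obtain S where S: "\<forall>x y. cinner (T x) y = cinner x (S y)" by metis
  have "cadjoint T = S"
    unfolding cadjoint_def
  proof (rule the_equality[of _ S])
    fix S' assume "\<forall>x y. cinner (T x) y = cinner x (S' y)"
    then have "S' y = S y" for y by (intro cinner_right_ext) (simp add: S[rule_format, symmetric])
    then show "S' = S" by blast
  qed (rule S)
  then show ?thesis using S by simp
qed

lemma cinner_cadjoint_funpow:
  fixes T :: "'a::chilbert_space \<Rightarrow> 'a"
  assumes "bounded_clinear T"
  shows "cinner ((T ^^ n) x) y = cinner x ((cadjoint T ^^ n) y)"
proof (induction n arbitrary: x)
  case (Suc n)
  have "cinner ((T ^^ Suc n) x) y = cinner ((T ^^ n) (T x)) y" by (simp add: funpow_swap1)
  also have "\<dots> = cinner x (cadjoint T ((cadjoint T ^^ n) y))"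
    by (simp add: Suc.IH cinner_cadjoint[OF assms])
  finally show ?case by simp
qed simp

lemma cinner_cadjoint_funpow_left:
  fixes T :: "'a::chilbert_space \<Rightarrow> 'a"
  assumes "bounded_clinear T"
  shows "cinner ((cadjoint T ^^ n) x) y = cinner x ((T ^^ n) y)"
  by (metis assms cinner_cadjoint_funpow cinner_commute)

lemma bounded_clinear_funpow:
  fixes T :: "'a::complex_inner \<Rightarrow> 'a"
  assumes "bounded_clinear T"
  shows "bounded_clinear (T ^^ n)"
proof (induction n)
  case 0
  have "T ^^ 0 = (\<lambda>x. x)" by (simp add: fun_eq_iff)
  then show ?case
    unfolding bounded_clinear_def by (simp only: bounded_linear_ident simp_thms)
next
  case (Suc n)
  then show ?case
    using assms bounded_linear_compose[of T "T ^^ n"] by (simp add: bounded_clinear_def comp_def)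
qed


section \<open>Hyponormality as positivity of the power matrix\<close>

text \<open>The quadratic form of the operator matrix with entries \<open>T\<^sup>*\<^sup>j T\<^sup>i\<close>, written without adjoints.\<close>

definition hyponormal_form :: "nat \<Rightarrow> ('a::chilbert_space \<Rightarrow> 'a) \<Rightarrow> (nat \<Rightarrow> 'a) \<Rightarrow> complex" where
  "hyponormal_form k T y = (\<Sum>i=0..k. \<Sum>j=0..k. cinner ((T ^^ i) (y j)) ((T ^^ j) (y i)))"

lemma sum_eq_cnj_swap_imp_Reals:
  assumes "\<And>i j. cnj (f i j) = f j i"
  shows "(\<Sum>i\<in>A. \<Sum>j\<in>A. f i j) \<in> \<real>"
proof -
  have "cnj (\<Sum>i\<in>A. \<Sum>j\<in>A. f i j) = (\<Sum>i\<in>A. \<Sum>j\<in>A. f j i)" by (simp add: assms)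
  also have "\<dots> = (\<Sum>i\<in>A. \<Sum>j\<in>A. f i j)" by (rule sum.swap)
  finally show ?thesis by (simp add: Reals_cnj_iff)
qed

lemma hyponormal_form_real: "hyponormal_form k T y \<in> \<real>"
  unfolding hyponormal_form_def
  by (rule sum_eq_cnj_swap_imp_Reals) (rule cinner_commute[symmetric])

text \<open>Row and column \<open>0\<close> of the matrix \<open>T\<^sup>*\<^sup>j T\<^sup>i\<close> contribute \<open>\<parallel>y\<^sub>0\<parallel>\<^sup>2 + 2 Re \<langle>y\<^sub>0, s\<rangle>\<close> with
  \<open>s = \<Sum> T\<^sup>*\<^sup>j y\<^sub>j\<close>. Completing the square costs \<open>\<parallel>s\<parallel>\<^sup>2 = \<Sum> \<langle>T\<^sup>i T\<^sup>*\<^sup>j y\<^sub>j, y\<^sub>i\<rangle>\<close>, which turns the remaining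
  products into commutators.\<close>

lemma hyponormal_form_completed_square:
  fixes T :: "'a::chilbert_space \<Rightarrow> 'a"
  assumes T: "bounded_clinear T"
  shows "hyponormal_form k T y =
    of_real ((norm (y 0 + (\<Sum>j=1..k. (cadjoint T ^^ j) (y j))))\<^sup>2) +
    (\<Sum>i=1..k. \<Sum>j=1..k. cinner (commutator (cadjoint T ^^ j) (T ^^ i) (y j)) (y i))"
proof -
  let ?S = "cadjoint T"
  define s where "s = (\<Sum>j=1..k. (?S ^^ j) (y j))"
  define A where "A = (\<Sum>i=1..k. \<Sum>j=1..k. cinner ((T ^^ i) (y j)) ((T ^^ j) (y i)))"
  have set: "{0..k} = insert 0 {1..k}" by auto
  have row: "(\<Sum>i=1..k. cinner ((T ^^ i) (y 0)) (y i)) = cinner (y 0) s"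
    by (simp add: s_def cinner_sum_right cinner_cadjoint_funpow[OF T])
  have col: "(\<Sum>j=1..k. cinner (y j) ((T ^^ j) (y 0))) = cinner s (y 0)"
    by (simp add: s_def cinner_sum_left cinner_cadjoint_funpow_left[OF T])
  have F: "hyponormal_form k T y = cinner (y 0) (y 0) + cinner s (y 0) + (cinner (y 0) s + A)"
    unfolding hyponormal_form_def set
    by (simp add: sum.distrib row[simplified] col[simplified] A_def)
  have "(\<Sum>i=1..k. \<Sum>j=1..k. cinner (commutator (?S ^^ j) (T ^^ i) (y j)) (y i))
      = A - (\<Sum>i=1..k. \<Sum>j=1..k. cinner ((?S ^^ j) (y j)) ((?S ^^ i) (y i)))"
    by (simp add: A_def commutator_def cinner_diff_left sum_subtractf
        cinner_cadjoint_funpow_left[OF T] cinner_cadjoint_funpow[OF T, of _ "(?S ^^ _) _"])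
  also have "(\<Sum>i=1..k. \<Sum>j=1..k. cinner ((?S ^^ j) (y j)) ((?S ^^ i) (y i))) = cinner s s"
    by (simp add: s_def cinner_sum_left cinner_sum_right)
  finally show ?thesis
    unfolding F s_def[symmetric]
    by (simp add: cinner_self[symmetric] cinner_add_left cinner_add_right del: of_real_power)
qed

text \<open>In the completed square \<open>y\<^sub>0\<close> is free, and one choice of it makes the square vanish. Reality of the
  form is automatic, so only the sign of its real part matters.\<close>

lemma k_hyponormal_iff_form:
  fixes T :: "'a::chilbert_space \<Rightarrow> 'a"
  assumes T: "bounded_clinear T"
  shows "k_hyponormal k T \<longleftrightarrow> (\<forall>y. 0 \<le> Re (hyponormal_form k T y))"
proof
  assume "k_hyponormal k T"
  then show "\<forall>y. 0 \<le> Re (hyponormal_form k T y)"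
    unfolding k_hyponormal_def hyponormal_form_completed_square[OF T]
    by (auto simp: complex_nonneg_Reals_iff)
next
  assume pos: "\<forall>y. 0 \<le> Re (hyponormal_form k T y)"
  show "k_hyponormal k T"
    unfolding k_hyponormal_def
  proof (intro conjI T allI)
    fix y :: "nat \<Rightarrow> 'a"
    define y' where "y' = y(0 := - (\<Sum>j=1..k. (cadjoint T ^^ j) (y j)))"
    have "hyponormal_form k T y' =
        (\<Sum>i=1..k. \<Sum>j=1..k. cinner (commutator (cadjoint T ^^ j) (T ^^ i) (y j)) (y i))"
      unfolding hyponormal_form_completed_square[OF T] by (simp add: y'_def)
    then show "(\<Sum>i=1..k. \<Sum>j=1..k. cinner (commutator (cadjoint T ^^ j) (T ^^ i) (y j)) (y i))
        \<in> \<real>\<^sub>\<ge>\<^sub>0"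
      using pos hyponormal_form_real[of k T y'] 
      by (metis complex_nonneg_Reals_iff complex_is_Real_iff)
  qed
qed


section \<open>Moments of a subnormal operator\<close>

lemma funpow_commute:
  assumes "\<And>x. f (g x) = g (f x)"
  shows "(f ^^ a) ((g ^^ b) x) = (g ^^ b) ((f ^^ a) x)"
proof -
  have step: "f ((g ^^ b) x) = (g ^^ b) (f x)" for x
    by (induction b) (simp_all add: assms)
  show ?thesis by (induction a) (simp_all add: step)
qed

text \<open>Move \<open>N\<^sup>a\<close> from the right factor of \<open>\<langle>N\<^sup>b N\<^sup>a w, N\<^sup>a N\<^sup>b w\<rangle>\<close> to the left as \<open>N\<^sup>*\<^sup>a\<close>, commute it past \<open>N\<^sup>b\<close>
  by normality, and move \<open>N\<^sup>b\<close> back to the right.\<close>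

lemma normal_operator_gram:
  fixes N :: "'a::chilbert_space \<Rightarrow> 'a"
  assumes "normal_operator N"
  defines "u \<equiv> \<lambda>w a. (cadjoint N ^^ a) ((N ^^ a) w)"
  shows "of_real ((norm ((N ^^ (a + b)) w))\<^sup>2) = cinner (u w a) (u w b)"
proof -
  let ?S = "cadjoint N"
  have N: "bounded_clinear N" and "\<And>x. ?S (N x) - N (?S x) = 0"
    using assms(1) by (auto simp: normal_operator_def commutator_def fun_eq_iff)
  then have comm: "?S (N x) = N (?S x)" for x by simp
  have pow: "(N ^^ (a + b)) w = (N ^^ b) ((N ^^ a) w)" "(N ^^ (a + b)) w = (N ^^ a) ((N ^^ b) w)"
    by (metis add.commute comp_apply funpow_add)+
  have "of_real ((norm ((N ^^ (a + b)) w))\<^sup>2) = cinner ((N ^^ b) ((N ^^ a) w)) ((N ^^ a) ((N ^^ b) w))"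
    by (subst cinner_self[symmetric]) (metis pow)
  also have "\<dots> = cinner ((?S ^^ a) ((N ^^ b) ((N ^^ a) w))) ((N ^^ b) w)"
    by (simp add: cinner_cadjoint_funpow_left[OF N])
  also have "\<dots> = cinner ((N ^^ b) ((?S ^^ a) ((N ^^ a) w))) ((N ^^ b) w)"
    by (simp add: funpow_commute[where f = ?S and g = N, OF comm])
  also have "\<dots> = cinner (u w a) (u w b)"
    by (simp add: cinner_cadjoint_funpow[OF N] u_def)
  finally show ?thesis .
qed

text \<open>The form is the squared norm of \<open>\<Sum> z\<^sub>i u\<^sub>i\<close> for the Gram vectors of a normal extension. Arbitrary
  exponents \<open>a i\<close>, rather than multiples of \<open>i\<close>, allow index sets that do not begin at \<open>0\<close>.\<close>

lemma subnormal_moments_positive: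
  fixes T :: "'a::chilbert_space \<Rightarrow> 'a" and a :: "'i \<Rightarrow> nat"
  assumes "subnormal_in TYPE('b::chilbert_space) T"
  shows "0 \<le> Re (\<Sum>i\<in>I. \<Sum>j\<in>I. z j * cnj (z i) * of_real ((norm ((T ^^ (m + a i + a j)) v))\<^sup>2))"
proof -
  obtain N :: "'b \<Rightarrow> 'b" and V :: "'a \<Rightarrow> 'b" where N: "normal_operator N"
    and V: "\<And>x. norm (V x) = norm x" and NV: "\<And>x. N (V x) = V (T x)"
    using assms unfolding subnormal_in_def by blast
  have pow: "(N ^^ n) (V v) = V ((T ^^ n) v)" for n
    by (induction n) (simp_all add: NV)
  define u where "u c = (cadjoint N ^^ c) ((N ^^ c) ((N ^^ m) (V v)))" for c
  have "of_real ((norm ((T ^^ (m + a i + a j)) v))\<^sup>2) = cinner (u (a j)) (u (a i))" for i j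
  proof -
    have "norm ((T ^^ (m + a i + a j)) v) = norm ((N ^^ (m + a i + a j)) (V v))"
      by (simp add: pow V)
    also have "(N ^^ (m + a i + a j)) (V v) = (N ^^ (a j + a i)) ((N ^^ m) (V v))"
      by (metis (no_types) add.assoc add.commute comp_apply funpow_add)
    finally show ?thesis
      using normal_operator_gram[OF N, of "a j" "a i" "(N ^^ m) (V v)"] by (simp add: u_def)
  qed
  then have "(\<Sum>i\<in>I. \<Sum>j\<in>I. z j * cnj (z i) * of_real ((norm ((T ^^ (m + a i + a j)) v))\<^sup>2))
      = cinner (\<Sum>j\<in>I. z j *\<^sub>C u (a j)) (\<Sum>i\<in>I. z i *\<^sub>C u (a i))"
    by (simp add: cinner_sum_left cinner_sum_right cinner_scaleC_left cinner_scaleC_right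
        sum_distrib_left mult_ac)
  then show ?thesis by (simp add: cinner_self flip: of_real_power)
qed


section \<open>Powers of a weighted shift\<close>

text \<open>The product of consecutive weights is written as a quotient of two initial products, so that the
  two denominators of a matrix entry can later be absorbed into the two vectors.\<close>

lemma weighted_shift_funpow_nth:
  assumes "weight_sequence \<beta>"
  shows "ell2_nth ((weighted_shift \<beta> ^^ n) f) p =
    (if n \<le> p then of_real ((\<Prod>i<p. \<beta> i) / (\<Prod>i<p - n. \<beta> i)) * ell2_nth f (p - n) else 0)"
proof (induction n arbitrary: p)
  case 0
  have "(\<Prod>i<p. \<beta> i) \<noteq> 0" using assms by (simp add: weight_sequence_def less_imp_neq)
      (metis less_irrefl)
  then show ?case by simp
next
  case (Suc n)
  have B: "Bseq \<beta>" using assms by (simp add: weight_sequence_def)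
  show ?case
    by (cases p) (simp_all add: ell2_nth_weighted_shift[OF B] Suc.IH lessThan_Suc)
qed

lemma weighted_shift_funpow_basis:
  assumes "Bseq \<beta>"
  shows "(weighted_shift \<beta> ^^ n) (ell2_basis 0) = (\<Prod>i<n. \<beta> i) *\<^sub>R ell2_basis n"
proof (induction n)
  case (Suc n)
  interpret bounded_linear "weighted_shift \<beta>"
    using bounded_clinear_weighted_shift[OF assms] by (simp add: bounded_clinear_def)
  show ?case by (simp add: Suc.IH scaleR weighted_shift_basis[OF assms] lessThan_Suc mult.commute)
qed simp

lemma norm_ell2_basis [simp]: "norm (ell2_basis n) = 1"
proof -
  have "(\<lambda>m. (cmod (if m = n then 1 else 0))\<^sup>2) = (\<lambda>m. if m = n then 1 else (0::real))"
    by auto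
  then show ?thesis
    using sums_single[of n "\<lambda>_. 1::real"] by (simp add: norm_ell2.rep_eq ell2_basis.rep_eq sums_iff)
qed

lemma norm_weighted_shift_funpow_basis:
  assumes "Bseq \<beta>"
  shows "(norm ((weighted_shift \<beta> ^^ n) (ell2_basis 0)))\<^sup>2 = moment \<beta> n"
  by (simp add: weighted_shift_funpow_basis[OF assms] moment_def prod_power_distrib)

lemma weight_sequence_back_step:
  assumes "weight_sequence \<alpha>" "x > 0"
  shows "weight_sequence (back_step x \<alpha>)"
proof -
  have "Bseq (\<lambda>n. back_step x \<alpha> (Suc n))"
    using assms by (simp add: back_step_def weight_sequence_def)
  then have "Bseq (back_step x \<alpha>)" by (simp only: Bseq_Suc_iff)
  then show ?thesis
    using assms by (auto simp: weight_sequence_def back_step_def split: nat.split)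
qed

lemma moment_back_step_Suc: "moment (back_step x \<alpha>) (Suc n) = x\<^sup>2 * moment \<alpha> n"
  unfolding moment_def by (subst prod.lessThan_Suc_shift) (simp add: back_step_def)

lemma D_matrix_entry:
  assumes "x > 0" "l \<ge> 1" "i \<le> k" "j \<le> k"
  shows "x\<^sup>2 * D_matrix \<alpha> x k l $$ (i, j) = moment (back_step x \<alpha>) ((i + j) * l)"
proof (cases "i = 0 \<and> j = 0")
  case True
  then show ?thesis using assms by (simp add: D_matrix_def moment_def)
next
  case False
  then have "(i + j) * l = Suc ((i + j) * l - 1)" using assms by (cases "(i + j) * l") auto
  then have "moment (back_step x \<alpha>) ((i + j) * l) = x\<^sup>2 * moment \<alpha> ((i + j) * l - 1)"
    by (metis moment_back_step_Suc)
  then show ?thesis using assms False by (auto simp: D_matrix_def)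
qed

text \<open>Scaling by \<open>x\<^sup>2\<close> removes the exceptional corner: \<open>x\<^sup>2 D\<close> is the Hankel matrix of the moments of the
  back-step extension at multiples of \<open>l\<close>.\<close>

lemma pos_semidef_D_matrix_iff:
  assumes "x > 0" "l \<ge> 1"
  shows "pos_semidef (D_matrix \<alpha> x k l) \<longleftrightarrow>
    (\<forall>c. 0 \<le> (\<Sum>i=0..k. \<Sum>j=0..k. c j * c i * moment (back_step x \<alpha>) ((i + j) * l)))"
    (is "_ \<longleftrightarrow> (\<forall>c. 0 \<le> ?Q c)")
proof -
  let ?D = "D_matrix \<alpha> x k l"
  have dim: "?D \<in> carrier_mat (k + 1) (k + 1)" by (simp add: D_matrix_def)
  have sym: "transpose_mat ?D = ?D"
    by (rule eq_matI) (auto simp: D_matrix_def add.commute)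
  have form: "x\<^sup>2 * (v \<bullet> (?D *\<^sub>v v)) = ?Q (\<lambda>i. v $ i)" if "v \<in> carrier_vec (k + 1)" for v
  proof -
    have set: "{0..<k + 1} = {0..k}" by auto
    have "v \<bullet> (?D *\<^sub>v v) = (\<Sum>i=0..k. v $ i * (\<Sum>j=0..k. ?D $$ (i, j) * v $ j))"
      using dim that by (simp add: scalar_prod_def row_def set del: sum.op_ivl_Suc)
        (simp add: atLeastLessThanSuc_atLeastAtMost)
    then have "x\<^sup>2 * (v \<bullet> (?D *\<^sub>v v)) =
        (\<Sum>i=0..k. \<Sum>j=0..k. v $ j * v $ i * (x\<^sup>2 * ?D $$ (i, j)))"
      by (simp add: sum_distrib_left mult_ac)
    also have "\<dots> = ?Q (\<lambda>i. v $ i)"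
      by (intro sum.cong refl) (simp add: D_matrix_entry[OF assms])
    finally show ?thesis .
  qed
  have "pos_semidef ?D \<longleftrightarrow> (\<forall>v \<in> carrier_vec (k + 1). 0 \<le> v \<bullet> (?D *\<^sub>v v))"
    using dim sym by (simp add: pos_semidef_def)
  also have "\<dots> \<longleftrightarrow> (\<forall>v \<in> carrier_vec (k + 1). 0 \<le> ?Q (\<lambda>i. v $ i))"
    using \<open>x > 0\<close> by (intro ball_cong refl) (simp add: form[symmetric] zero_le_mult_iff)
  also have "\<dots> \<longleftrightarrow> (\<forall>c. 0 \<le> ?Q c)"
  proof safe
    fix c assume "\<forall>v \<in> carrier_vec (k + 1). 0 \<le> ?Q (\<lambda>i. v $ i)"
    then have "0 \<le> ?Q (\<lambda>i. vec (k + 1) c $ i)" by (rule bspec) simp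
    also have "?Q (\<lambda>i. vec (k + 1) c $ i) = ?Q c" by (intro sum.cong refl) simp
    finally show "0 \<le> ?Q c" .
  qed blast
  finally show ?thesis .
qed


section \<open>The power matrix of a shift, slice by slice\<close>

lemma complex_quadratic_form_Re:
  fixes z :: "nat \<Rightarrow> complex"
  shows "Re (\<Sum>i\<in>I. \<Sum>j\<in>I. z j * cnj (z i) * of_real (M i j)) =
    (\<Sum>i\<in>I. \<Sum>j\<in>I. Re (z j) * Re (z i) * M i j) + (\<Sum>i\<in>I. \<Sum>j\<in>I. Im (z j) * Im (z i) * M i j)"
  by (simp add: sum.distrib algebra_simps)

text \<open>Here \<open>n\<close> is the slice number shifted up by \<open>2 k l\<close>, which keeps it natural, and \<open>z\<close> is supported on
  the active indices. At \<open>n = 2 k l\<close> the matrix is a multiple of \<open>D\<close>. Otherwise let \<open>r\<close> be the first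
  active index: the smallest moment index that occurs, \<open>n + 2 r l - 2 k l\<close>, is at least \<open>1\<close>, so the
  whole slice only involves moments of \<open>\<alpha>\<close>.\<close>

lemma back_step_slice_nonneg:
  fixes z :: "nat \<Rightarrow> complex"
  assumes \<alpha>: "weight_sequence \<alpha>"
    and sub: "subnormal_in TYPE('b::chilbert_space) (weighted_shift \<alpha>)"
    and l: "l \<ge> 1"
    and Q: "\<And>c. 0 \<le> (\<Sum>i=0..k. \<Sum>j=0..k. c j * c i * moment (back_step x \<alpha>) ((i + j) * l))"
    and z: "\<And>i. n + i * l < 2 * k * l \<Longrightarrow> z i = 0"
  shows "0 \<le> Re (\<Sum>i=0..k. \<Sum>j=0..k. z j * cnj (z i) *
    of_real (moment (back_step x \<alpha>) (n + (i + j) * l - 2 * k * l)))"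
proof (cases "n = 2 * k * l")
  case True
  show ?thesis
    unfolding complex_quadratic_form_Re True
    using Q[of "\<lambda>i. Re (z i)"] Q[of "\<lambda>i. Im (z i)"] by simp
next
  case n: False
  show ?thesis
  proof (cases "\<exists>i. 2 * k * l \<le> n + i * l")
    case False
    then have "z i = 0" for i using z[of i] by (simp add: not_le)
    then show ?thesis by simp
  next
    case True
    define r where "r = (LEAST i. 2 * k * l \<le> n + i * l)"
    have r: "2 * k * l \<le> n + r * l" unfolding r_def using True by (rule LeastI_ex)
    have least: "z i = 0" if "i < r" for i
      using z[of i] not_less_Least[of i "\<lambda>i. 2 * k * l \<le> n + i * l"] that
      unfolding r_def by (simp add: not_le)
    define m where "m = n + 2 * (r * l) - 2 * k * l - 1"
    have pos: "2 * k * l + 1 \<le> n + 2 * (r * l)"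
    proof (cases "r = 0")
      case True
      then show ?thesis using r n by simp
    next
      case False
      then have "1 \<le> r * l" using l by simp
      then show ?thesis using r by linarith
    qed
    have B: "Bseq \<alpha>" using \<alpha> by (simp add: weight_sequence_def)
    have entry: "z j * cnj (z i) * of_real (moment (back_step x \<alpha>) (n + (i + j) * l - 2 * k * l)) =
        of_real (x\<^sup>2) * (z j * cnj (z i) * of_real ((norm ((weighted_shift \<alpha> ^^
          (m + (i * l - r * l) + (j * l - r * l))) (ell2_basis 0)))\<^sup>2))" for i j
    proof (cases "r \<le> i \<and> r \<le> j")
      case True
      then have "r * l \<le> i * l" "r * l \<le> j * l" by (auto intro: mult_le_mono1)
      then have "n + (i + j) * l - 2 * k * l = Suc (m + (i * l - r * l) + (j * l - r * l))"
        using pos unfolding m_def add_mult_distrib by linarith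
      then show ?thesis
        by (simp only: moment_back_step_Suc norm_weighted_shift_funpow_basis[OF B]) simp
    next
      case False
      then show ?thesis using least[of i] least[of j] by auto
    qed
    define G where "G = (\<Sum>i=0..k. \<Sum>j=0..k. z j * cnj (z i) * of_real ((norm ((weighted_shift \<alpha> ^^
          (m + (i * l - r * l) + (j * l - r * l))) (ell2_basis 0)))\<^sup>2))"
    have "0 \<le> Re G"
      unfolding G_def by (rule subnormal_moments_positive[OF sub, where a = "\<lambda>i. i * l - r * l"])
    moreover have "(\<Sum>i=0..k. \<Sum>j=0..k. z j * cnj (z i) *
        of_real (moment (back_step x \<alpha>) (n + (i + j) * l - 2 * k * l))) = of_real (x\<^sup>2) * G"
      unfolding entry G_def sum_distrib_left ..
    moreover have "Re (of_real (x\<^sup>2) * G) = x\<^sup>2 * Re G" by simp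
    ultimately show ?thesis by (simp only: mult_nonneg_nonneg zero_le_power2)
  qed
qed

lemma sums_delay:
  fixes g :: "nat \<Rightarrow> 'a::real_normed_vector"
  assumes "g sums s"
  shows "(\<lambda>n. if d \<le> n then g (n - d) else 0) sums s"
  using assms sums_iff_shift[of "\<lambda>n. if d \<le> n then g (n - d) else 0" d s] by simp

lemma cinner_ell2_sums: "(\<lambda>p. ell2_nth f p * cnj (ell2_nth g p)) sums cinner f g"
  unfolding cinner_ell2.rep_eq
  using ell2_nth[of f] ell2_nth[of g] by (intro summable_sums ell2_cinner_summable) simp_all

text \<open>In the entry \<open>(i, j)\<close> the inner product at position \<open>p\<close> pairs \<open>y\<^sub>j (p - i l)\<close> with \<open>y\<^sub>i (p - j l)\<close>, so it
  belongs to the slice \<open>p - (i + j) l\<close>. Delaying each of the series by \<open>2 k l - (i + j) l\<close>, which is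
  never negative, aligns the slices, after which the finite double sum moves inside the series.\<close>

lemma hyponormal_form_shift_sums:
  fixes y :: "nat \<Rightarrow> ell2" and k l :: nat
  assumes \<beta>: "weight_sequence \<beta>"
  defines "z \<equiv> \<lambda>n i. if 2 * k * l \<le> n + i * l
    then ell2_nth (y i) (n + i * l - 2 * k * l) / of_real (\<Prod>q<n + i * l - 2 * k * l. \<beta> q) else 0"
  shows "(\<lambda>n. \<Sum>i=0..k. \<Sum>j=0..k. z n j * cnj (z n i) * of_real (moment \<beta> (n + (i + j) * l - 2 * k * l)))
    sums hyponormal_form k (weighted_shift \<beta> ^^ l) y"
proof -
  define T where "T = weighted_shift \<beta> ^^ l"
  define P where "P n = (\<Prod>q<n. \<beta> q)" for n
  define g where "g i j p = ell2_nth ((T ^^ i) (y j)) p * cnj (ell2_nth ((T ^^ j) (y i)) p)" for i j p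
  define d where "d i j = 2 * k * l - (i + j) * l" for i j
  have T: "ell2_nth ((T ^^ i) f) p =
      (if i * l \<le> p then of_real (P p / P (p - i * l)) * ell2_nth f (p - i * l) else 0)" for i f p
    unfolding T_def funpow_mult P_def
    by (simp only: weighted_shift_funpow_nth[OF \<beta>] mult.commute[of l i])
  have "(\<lambda>n. \<Sum>i=0..k. \<Sum>j=0..k. if d i j \<le> n then g i j (n - d i j) else 0)
      sums hyponormal_form k T y"
    unfolding hyponormal_form_def g_def by (intro sums_sum sums_delay cinner_ell2_sums)
  also have "(\<lambda>n. \<Sum>i=0..k. \<Sum>j=0..k. if d i j \<le> n then g i j (n - d i j) else 0) =
      (\<lambda>n. \<Sum>i=0..k. \<Sum>j=0..k. z n j * cnj (z n i) * of_real (moment \<beta> (n + (i + j) * l - 2 * k * l)))"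
  proof (intro ext sum.cong refl)
    fix n i j assume "i \<in> {0..k}" "j \<in> {0..k}"
    then have ij: "i * l \<le> k * l" "j * l \<le> k * l" by simp_all
    have side: "ell2_nth ((T ^^ i) f) (n - d i j) =
        (if 2 * k * l \<le> n + j * l then of_real (P (n + (i + j) * l - 2 * k * l)) *
          (ell2_nth f (n + j * l - 2 * k * l) / of_real (P (n + j * l - 2 * k * l))) else 0)"
      if "d i j \<le> n" "i * l \<le> k * l" "j * l \<le> k * l" for i j f
    proof -
      have index: "(I \<le> n - (2 * K - (I + J)) \<longleftrightarrow> 2 * K \<le> n + J) \<and>
          n - (2 * K - (I + J)) = n + (I + J) - 2 * K \<and>
          n - (2 * K - (I + J)) - I = n + J - 2 * K"
        if "2 * K - (I + J) \<le> n" "I \<le> K" "J \<le> K" for I J K :: nat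
        using that by linarith
      have "i * l \<le> n - d i j \<longleftrightarrow> 2 * k * l \<le> n + j * l"
        "n - d i j = n + (i + j) * l - 2 * k * l"
        "n - d i j - i * l = n + j * l - 2 * k * l"
        using index[of "k * l" "i * l" "j * l"] that
        unfolding d_def add_mult_distrib mult.assoc by blast+
      then show ?thesis unfolding T by simp
    qed
    have mom: "moment \<beta> q = (P q)\<^sup>2" for q
      by (simp add: moment_def P_def prod_power_distrib)
    show "(if d i j \<le> n then g i j (n - d i j) else 0) =
        z n j * cnj (z n i) * of_real (moment \<beta> (n + (i + j) * l - 2 * k * l))"
    proof (cases "d i j \<le> n")
      case True
      have "d j i = d i j" by (simp add: d_def add.commute)
      then show ?thesis
        using True ij side[of i j "y j"] side[of j i "y i"]
        by (simp add: g_def z_def mom P_def[symmetric] power2_eq_square add.commute[of j i])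
    next
      case False
      then have "\<not> 2 * k * l \<le> n + j * l" using ij by (simp add: d_def add_mult_distrib)
      then show ?thesis using False by (simp add: z_def)
    qed
  qed
  finally show ?thesis by (simp add: T_def)
qed

theorem theorem4p1:
  fixes \<alpha> :: "nat \<Rightarrow> real" and x :: real and l k :: nat
  assumes "weight_sequence \<alpha>"
    and "subnormal_in TYPE('b::chilbert_space) (weighted_shift \<alpha>)"
    and "x > 0" and "l \<ge> 1" and "k \<ge> 1"
  shows "k_hyponormal k (weighted_shift (back_step x \<alpha>) ^^ l) \<longleftrightarrow> pos_semidef (D_matrix \<alpha> x k l)"
proof -
  define \<beta> where "\<beta> = back_step x \<alpha>"
  let ?T = "weighted_shift \<beta> ^^ l"
  let ?Q = "\<lambda>c. \<Sum>i=0..k. \<Sum>j=0..k. c j * c i * moment \<beta> ((i + j) * l)"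
  have \<beta>: "weight_sequence \<beta>" unfolding \<beta>_def using assms by (intro weight_sequence_back_step)
  then have B: "Bseq \<beta>" by (simp add: weight_sequence_def)
  have "(\<forall>y. 0 \<le> Re (hyponormal_form k ?T y)) \<longleftrightarrow> (\<forall>c. 0 \<le> ?Q c)"
  proof
    assume pos: "\<forall>y. 0 \<le> Re (hyponormal_form k ?T y)"
    show "\<forall>c. 0 \<le> ?Q c"
    proof
      fix c :: "nat \<Rightarrow> real"
      have scale: "(?T ^^ i) (a *\<^sub>R f) = a *\<^sub>R (?T ^^ i) f" for i a f
        unfolding scaleR_scaleC
        using bounded_clinear_funpow[OF bounded_clinear_funpow[OF bounded_clinear_weighted_shift[OF B]]]
        by (simp add: bounded_clinear_def)
      \<comment> \<open>On these vectors the form only sees the norms of \<open>T\<^sup>i\<^sup>+\<^sup>j e\<^sub>0\<close>.\<close>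
      define y where "y j = c j *\<^sub>R (?T ^^ j) (ell2_basis 0)" for j
      have "cinner ((?T ^^ i) (y j)) ((?T ^^ j) (y i)) = of_real (c j * c i * moment \<beta> ((i + j) * l))"
        for i j
      proof -
        have pow: "(?T ^^ i) ((?T ^^ j) f) = (weighted_shift \<beta> ^^ ((i + j) * l)) f" for i j f
          by (simp only: funpow_mult mult.commute[of l] add_mult_distrib funpow_add comp_apply)
        have "(?T ^^ i) (y j) = c j *\<^sub>R (weighted_shift \<beta> ^^ ((i + j) * l)) (ell2_basis 0)" for i j
          by (simp add: y_def scale pow)
        then show ?thesis
          by (simp add: cinner_scaleR_left cinner_scaleR_right cinner_self add.commute[of j i]
              norm_weighted_shift_funpow_basis[OF B] flip: of_real_power)
      qed
      then have "hyponormal_form k ?T y = of_real (?Q c)" by (simp add: hyponormal_form_def)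
      moreover have "0 \<le> Re (hyponormal_form k ?T y)" using pos by blast
      ultimately show "0 \<le> ?Q c" by (simp only: Re_complex_of_real)
    qed
  next
    assume Q: "\<forall>c. 0 \<le> ?Q c"
    show "\<forall>y. 0 \<le> Re (hyponormal_form k ?T y)"
    proof
      fix y
      let ?z = "\<lambda>n i. if 2 * k * l \<le> n + i * l
        then ell2_nth (y i) (n + i * l - 2 * k * l) / of_real (\<Prod>q<n + i * l - 2 * k * l. \<beta> q) else 0"
      note sums = hyponormal_form_shift_sums[OF \<beta>, of k l y, THEN sums_Re]
      show "0 \<le> Re (hyponormal_form k ?T y)"
      proof (rule sums_le[OF _ sums_zero sums])
        fix n
        show "0 \<le> Re (\<Sum>i=0..k. \<Sum>j=0..k. ?z n j * cnj (?z n i) *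
            of_real (moment \<beta> (n + (i + j) * l - 2 * k * l)))"
          unfolding \<beta>_def
          by (rule back_step_slice_nonneg[OF assms(1,2,4)]) (use Q in \<open>simp_all add: \<beta>_def\<close>)
      qed
    qed
  qed
  moreover have "bounded_clinear ?T"
    by (intro bounded_clinear_funpow bounded_clinear_weighted_shift B)
  ultimately show ?thesis
    using k_hyponormal_iff_form pos_semidef_D_matrix_iff[OF assms(3,4), of \<alpha> k]
    unfolding \<beta>_def by blast
qed

end
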